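(* Let $\phi : Y\times\mathbb{R}^m_+\times[-1,1]^n\to\mathbb{R}$, the true distribution map $\mathcal{D}$, the model distribution map $\mathcal{D}_{\mathrm{ms}}$, and the sets $\mathcal{Y}\subset Y$, $\mathcal{M}\subset\mathbb{R}^m_+$ be as in the context, and suppose that, for constants $\mu>0$, $L>0$, $\varepsilon\ge 0$, $B\ge0$: (a) for every $z\in[-1,1]^n$, $\phi(\cdot,\cdot,z)$ is continuously differentiable on $Y\times\mathbb{R}^m_+$ and is $\mu$-strongly convex in $y$ and $\mu$-strongly concave in $\lambda$; (b) the stochastic gradient map $\psi(y,\lambda,z):=(\nabla_y\phi(y,\lambda,z),-\nabla_\lambda\phi(y,\lambda,z))$ is $L$-Lipschitz jointly in $(y,\lambda)$ for each fixed $z$, and $L$-Lipschitz in $z$ for each fixed $(y,\lambda)$; (c) $W_1(\mathcal{D}(y),\mathcal{D}(y'))\le\varepsilon\|y-y'\|$ for all $y,y'\in Y$; (d) $\mathcal{D}_{\mathrm{ms}}$ is $B$-misspecified: $W_1(\mathcal{D}_{\mathrm{ms}}(y),\mathcal{D}(y))\le B$ for all $y\in\mathcal{Y}$. Assume $\frac{\varepsilon L}{\mu}<1$ and let the step size satisfy $$\eta\in\left(0,\frac{2(\mu-\varepsilon L)}{L^2(1-\varepsilon^2)}\right).$$ Let $\bar p=(\bar y,\bar\lambda)$ be the unique equilibrium point with respect to the true distribution map $\mathcal{D}$ (defined in the context). From an arbitrary starting point $(y_0,\lambda_0)\in\mathcal{Y}\times\mathcal{M}$, let $p_k=(y_k,\lambda_k)$,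 $k=0,1,\dots$, be generated by the model-based primal-dual method $$y_{k+1}=\mathsf{P}_{\mathcal{Y}}\Big[y_k-\eta\,\mathbb{E}_{z\sim\mathcal{D}_{\mathrm{ms}}(y_k)}\nabla_y\phi(y_k,\lambda_k,z)\Big],\qquad \lambda_{k+1}=\mathsf{P}_{\mathcal{M}}\Big[\lambda_k+\eta\,\mathbb{E}_{z\sim\mathcal{D}_{\mathrm{ms}}(y_k)}\nabla_\lambda\phi(y_k,\lambda_k,z)\Big].$$ Then $\varrho:=\sqrt{1-2\eta\mu+\eta^2L^2}+\eta\varepsilon L<1$ and, deterministically, $$\limsup_{k\to\infty}\|p_k-\bar p\|\le\frac{\sqrt2\,\eta LB}{1-\varrho}.$$
   Context: $n,m\ge1$ are integers and $\|\cdot\|$ is the Euclidean norm. $Y:=\mathbb{R}^n\times\mathbb{R}^n_+$, with elements $y=(x,\beta)$; $\lambda\in\mathbb{R}^m_+$ is a vector of multipliers. The (true) distribution map $\mathcal{D}$ assigns to every $y\in Y$ a probability distribution $\mathcal{D}(y)$ supported in $[-1,1]^n$. $W_1$ is the Wasserstein-1 distance. $\mathcal{Y}\subset Y$ and $\mathcal{M}\subset\mathbb{R}^m_+$ are nonempty, convex and compact sets, and $\mathsf{P}_{\mathcal{Y}}$, $\mathsf{P}_{\mathcal{M}}$ denote Euclidean projections onto them. The underlying problem is the stochastic saddle-point problem with decision-dependent distribution $\min_{y}\max_{\lambda}\mathbb{E}_{z\sim\mathcal{D}(y)}[\phi(y,\lambda,z)]$, where $\phi$ is a (regularized) Lagrangian-type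 function; only the properties of $\phi$ listed in the claim are used. The model distribution map $\mathcal{D}_{\mathrm{ms}}$ assigns to every $y=(x,\beta)\in Y$ a probability distribution $\mathcal{D}_{\mathrm{ms}}(y)$ supported in $[-1,1]^n$: it is the law of $z=(z_1,\dots,z_n)$ induced by a user model in which $z_i$ is distributed as $\Psi_i(x_i,\beta_i)+\xi_i$, truncated so as to have support in $[-1,1]$, where $\Psi_i:\mathbb{R}^2\to\mathbb{R}$ is a given function and $\xi_i\sim\mathcal{D}_i$ for a fixed distribution $\mathcal{D}_i$ independent of $y$. The map $\Psi(y):=(\Psi_1(x_1,\beta_1),\dots,\Psi_n(x_n,\beta_n))$ is assumed $\varepsilon$-Lipschitz: $\|\Psi(y)-\Psi(y')\|\le\varepsilon\|y-y'\|$ for all $y,y'\in Y$. An equilibrium point is a pair $(\bar y,\bar\lambda)\in\mathcal{Y}\times\mathcal{M}$ such that $$\bar y\in\arg\min_{y\in\mathcal{Y}}\Big\{\max_{\lambda\in\mathcal{M}}\mathbb{E}_{z\sim\mathcal{D}(\bar y)}[\phi(y,\lambda,z)]\Big\},\qquad \bar\lambda\in\arg\max_{\lambda\in\mathcal{M}}\Big\{\min_{y\in\mathcal{Y}}\mathbb{E}_{z\sim\mathcal{D}(\bar y)}[\phi(y,\lambda,z)]\Big\}.$$ Under (a)-(c) and $\varepsilon L/\mu<1$ it is a known result that an equilibrium point exists and is unique. *)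

theory Defs
  imports "HOL-Probability.Probability"
begin

text \<open>A point \<open>(x, \<beta>)\<close> has its components in two copies of \<open>\<real>\<^sup>n\<close>; the norm of the product types
  below is the Euclidean norm of the concatenated vector.\<close>

type_synonym 'n decision = "(real ^ 'n) \<times> (real ^ 'n)"

definition nonneg_orthant :: "(real ^ 'k::finite) set" where
  "nonneg_orthant = {v. \<forall>i. 0 \<le> v $ i}"

definition decision_space :: "'n::finite decision set" where
  "decision_space = UNIV \<times> nonneg_orthant"

definition cube :: "(real ^ 'n::finite) set" where
  "cube = {z. \<forall>i. -1 \<le> z $ i \<and> z $ i \<le> 1}"


subsection \<open>Distribution maps\<close>

text \<open>Distributions supported in the cube are represented as probability measures on the Borel
  sets of the cube, so that integrands need only be meaningful there.\<close>

definition distribution_map ::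
    "('n::finite decision \<Rightarrow> (real ^ 'n) measure) \<Rightarrow> bool" where
  "distribution_map D \<longleftrightarrow>
     (\<forall>y\<in>decision_space. prob_space (D y) \<and> sets (D y) = sets (restrict_space borel cube))"

definition couplings :: "'a measure \<Rightarrow> 'a measure \<Rightarrow> ('a \<times> 'a) measure set" where
  "couplings P Q = {G. sets G = sets (P \<Otimes>\<^sub>M Q) \<and> distr G P fst = P \<and> distr G Q snd = Q}"

definition W1 :: "'a::metric_space measure \<Rightarrow> 'a measure \<Rightarrow> ennreal" where
  "W1 P Q = (INF G\<in>couplings P Q. \<integral>\<^sup>+ w. ennreal (dist (fst w) (snd w)) \<partial>G)"

text \<open>Two ways of truncating a law on the line to \<open>[-1, 1]\<close>: saturating the values, and
  conditioning on the interval.\<close>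

definition saturate_law :: "real measure \<Rightarrow> real measure" where
  "saturate_law P = distr P borel (\<lambda>t. max (-1) (min 1 t))"

definition condition_law :: "real measure \<Rightarrow> real measure" where
  "condition_law P = uniform_measure P {-1..1}"

text \<open>The user model prescribes the law of every coordinate of \<open>z\<close>; the dependence between the
  coordinates is left open. If \<open>trunc\<close> is \<^const>\<open>condition_law\<close>, the conditioning event
  automatically has positive probability, since otherwise the right-hand side would be the null
  measure.\<close>

definition user_model ::
    "(real measure \<Rightarrow> real measure) \<Rightarrow> ('n::finite \<Rightarrow> real \<Rightarrow> real \<Rightarrow> real) \<Rightarrow>
     ('n \<Rightarrow> real measure) \<Rightarrow> ('n decision \<Rightarrow> (real ^ 'n) measure) \<Rightarrow> bool" where
  "user_model trunc \<Psi> N D \<longleftrightarrow>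
     distribution_map D \<and>
     (\<forall>i. prob_space (N i) \<and> sets (N i) = sets borel) \<and>
     (\<forall>(x, \<beta>)\<in>decision_space. \<forall>i.
        distr (D (x, \<beta>)) borel (\<lambda>z. z $ i) =
        trunc (distr (N i) borel (\<lambda>\<xi>. \<Psi> i (x $ i) (\<beta> $ i) + \<xi>)))"


subsection \<open>Gradients and strong convexity on a set\<close>

text \<open>The sets used below are convex with nonempty interior, so a gradient relative to the set is
  unique when it exists, also at boundary points.\<close>

definition gradient_on :: "'a::real_inner set \<Rightarrow> ('a \<Rightarrow> real) \<Rightarrow> 'a \<Rightarrow> 'a" where
  "gradient_on S f x = (SOME g. (f has_derivative (\<lambda>h. g \<bullet> h)) (at x within S))"

definition continuously_differentiable_on :: "('a::euclidean_space \<Rightarrow> real) \<Rightarrow> 'a set \<Rightarrow> bool" where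
  "continuously_differentiable_on f S \<longleftrightarrow>
     f differentiable_on S \<and> continuous_on S (gradient_on S f)"

definition strongly_convex_on :: "real \<Rightarrow> 'a::real_inner set \<Rightarrow> ('a \<Rightarrow> real) \<Rightarrow> bool" where
  "strongly_convex_on \<mu> S f \<longleftrightarrow>
     convex S \<and>
     (\<forall>u\<in>S. \<forall>v\<in>S. \<forall>t\<in>{0..1}.
        f ((1 - t) *\<^sub>R u + t *\<^sub>R v)
          \<le> (1 - t) * f u + t * f v - \<mu> / 2 * t * (1 - t) * (norm (u - v))\<^sup>2)"

definition strongly_concave_on :: "real \<Rightarrow> 'a::real_inner set \<Rightarrow> ('a \<Rightarrow> real) \<Rightarrow> bool" where
  "strongly_concave_on \<mu> S f \<longleftrightarrow> strongly_convex_on \<mu> S (\<lambda>u. - f u)"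


subsection \<open>The saddle-point problem\<close>

definition grad_y ::
    "('n::finite decision \<Rightarrow> real ^ 'm::finite \<Rightarrow> real ^ 'n \<Rightarrow> real) \<Rightarrow>
     'n decision \<Rightarrow> real ^ 'm \<Rightarrow> real ^ 'n \<Rightarrow> 'n decision" where
  "grad_y \<phi> y l z = gradient_on decision_space (\<lambda>y'. \<phi> y' l z) y"

definition grad_lambda ::
    "('n::finite decision \<Rightarrow> real ^ 'm::finite \<Rightarrow> real ^ 'n \<Rightarrow> real) \<Rightarrow>
     'n decision \<Rightarrow> real ^ 'm \<Rightarrow> real ^ 'n \<Rightarrow> real ^ 'm" where
  "grad_lambda \<phi> y l z = gradient_on nonneg_orthant (\<lambda>l'. \<phi> y l' z) l"

definition stochastic_gradient_map ::
    "('n::finite decision \<Rightarrow> real ^ 'm::finite \<Rightarrow> real ^ 'n \<Rightarrow> real) \<Rightarrow>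
     'n decision \<Rightarrow> real ^ 'm \<Rightarrow> real ^ 'n \<Rightarrow> 'n decision \<times> (real ^ 'm)" where
  "stochastic_gradient_map \<phi> y l z = (grad_y \<phi> y l z, - grad_lambda \<phi> y l z)"

text \<open>The inner maximum and minimum are written as supremum and infimum. For the compact constraint
  sets and the continuous expected objectives to which this is applied they are attained.\<close>

definition equilibrium_point ::
    "('n::finite decision \<Rightarrow> real ^ 'm::finite \<Rightarrow> real ^ 'n \<Rightarrow> real) \<Rightarrow>
     ('n decision \<Rightarrow> (real ^ 'n) measure) \<Rightarrow> 'n decision set \<Rightarrow> (real ^ 'm) set \<Rightarrow>
     'n decision \<times> (real ^ 'm) \<Rightarrow> bool" where
  "equilibrium_point \<phi> D YY MM p \<longleftrightarrow>
     (case p of (ybar, lbar) \<Rightarrow>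
        is_arg_min (\<lambda>y. SUP l\<in>MM. \<integral>z. \<phi> y l z \<partial>D ybar) (\<lambda>y. y \<in> YY) ybar \<and>
        is_arg_max (\<lambda>l. INF y\<in>YY. \<integral>z. \<phi> y l z \<partial>D ybar) (\<lambda>l. l \<in> MM) lbar)"

end

theory Submission
  imports Defs
begin

text \<open>For the law frozen at the equilibrium, the projected gradient step is a contraction with factor
  \<open>sqrt (1 - 2 * \<eta> * \<mu> + \<eta>\<^sup>2 * L\<^sup>2)\<close>, and the equilibrium point is its fixed point. Replacing the
  frozen law by the true law at \<open>y k\<close>, and that by the model law, moves the expected gradient by at
  most \<open>\<epsilon> * L * norm (y k - ybar)\<close> and \<open>L * B\<close> respectively: integrating against a
  coupling bounds the change of the expectation of a vector-valued \<open>L\<close>-Lipschitz function by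
  \<open>L\<close> times the Wasserstein distance, without a dimensional constant. Hence the distances to the
  equilibrium satisfy an affine recurrence with factor \<open>\<rho>\<close> and offset \<open>\<eta> * L * B\<close>; the factor
  \<open>sqrt 2\<close> in the bound is slack.\<close>

section \<open>Relative gradients and monotonicity of saddle gradients\<close>

lemma has_derivative_gradient_on:
  fixes f :: "'a::euclidean_space \<Rightarrow> real"
  assumes "f differentiable (at x within S)"
  shows "(f has_derivative (\<lambda>h. gradient_on S f x \<bullet> h)) (at x within S)"
proof -
  obtain f' where f': "(f has_derivative f') (at x within S)"
    using assms unfolding differentiable_def by blast
  \<comment> \<open>A linear functional is the inner product with the vector of its values on the
    basis. So a gradient vector exists and the choice in \<open>gradient_on\<close> yields
    one.\<close>
  have "f' h = (\<Sum>b\<in>Basis. f' b *\<^sub>R b) \<bullet> h" for h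
  proof -
    have "f' h = f' (\<Sum>b\<in>Basis. (h \<bullet> b) *\<^sub>R b)"
      by (simp add: euclidean_representation)
    also have "\<dots> = (\<Sum>b\<in>Basis. (h \<bullet> b) * f' b)"
      using has_derivative_linear[OF f'] by (simp add: linear_sum linear_scale)
    also have "\<dots> = (\<Sum>b\<in>Basis. f' b *\<^sub>R b) \<bullet> h"
      by (simp add: inner_sum_left inner_commute[of h] mult.commute)
    finally show ?thesis .
  qed
  then have "f' = (\<lambda>h. (\<Sum>b\<in>Basis. f' b *\<^sub>R b) \<bullet> h)" by blast
  with f' show ?thesis
    unfolding gradient_on_def by (metis (mono_tags, lifting) someI_ex)
qed

text \<open>Along the segment from \<open>u\<close> to \<open>v\<close>, strong convexity bounds the
  difference quotient of \<open>f\<close>; let the parameter tend to 0. The limit is one-sided, so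
  the argument also covers boundary points of \<open>S\<close>.\<close>

lemma strongly_convex_on_first_order:
  fixes f :: "'a::real_inner \<Rightarrow> real"
  assumes sc: "strongly_convex_on \<mu> S f" and "u \<in> S" "v \<in> S"
    and der: "(f has_derivative (\<lambda>h. g \<bullet> h)) (at u within S)"
  shows "f u + g \<bullet> (v - u) + \<mu> / 2 * (norm (v - u))\<^sup>2 \<le> f v"
proof -
  define c where "c t = u + t *\<^sub>R (v - u)" for t :: real
  have c_alt: "c t = (1 - t) *\<^sub>R u + t *\<^sub>R v" for t
    by (simp add: c_def algebra_simps)
  have c_in: "c ` {0..1} \<subseteq> S"
    using sc assms(2,3) unfolding strongly_convex_on_def c_alt
    by (auto intro: convexD_alt)
  have dc: "(c has_derivative (\<lambda>t. t *\<^sub>R (v - u))) (at 0 within {0..1})"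
    unfolding c_def by (auto intro!: derivative_eq_intros)
  \<comment> \<open>Convexity keeps the segment in \<open>S\<close>, so the derivative restricts to
    its image, as the chain rule asks.\<close>
  have "(f has_derivative (\<lambda>h. g \<bullet> h)) (at (c 0) within c ` {0..1})"
    using has_derivative_subset[OF der c_in] by (simp add: c_def)
  from diff_chain_within[OF dc this]
  have "((\<lambda>t. f (c t)) has_real_derivative g \<bullet> (v - u)) (at 0 within {0..1})"
    unfolding has_field_derivative_def by (simp add: o_def mult.commute[of _ "g \<bullet> (v - u)"])
  then have lim: "((\<lambda>t. (f (c t) - f u) / t) \<longlongrightarrow> g \<bullet> (v - u)) (at 0 within {0..1})"
    unfolding has_field_derivative_iff by (simp add: c_def)
  have "((\<lambda>t. f v - f u - \<mu> / 2 * (1 - t) * (norm (u - v))\<^sup>2)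
      \<longlongrightarrow> f v - f u - \<mu> / 2 * (1 - 0) * (norm (u - v))\<^sup>2) (at (0::real) within {0..1})"
    by (intro tendsto_intros)
  moreover have "\<forall>\<^sub>F t in at (0::real) within {0..1}.
      (f (c t) - f u) / t \<le> f v - f u - \<mu> / 2 * (1 - t) * (norm (u - v))\<^sup>2"
    unfolding eventually_at_filter
  proof (intro always_eventually allI impI)
    fix t :: real assume t: "t \<noteq> 0" "t \<in> {0..1}"
    have "f (c t) \<le> (1 - t) * f u + t * f v - \<mu> / 2 * t * (1 - t) * (norm (u - v))\<^sup>2"
      using sc assms(2,3) t unfolding strongly_convex_on_def c_alt by blast
    \<comment> \<open>After division by \<open>t\<close> the quadratic term keeps the factor
      \<open>1 - t\<close>, which tends to 1, so the full \<mu> / 2 survives the limit.\<close>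
    then have "f (c t) - f u \<le> (f v - f u - \<mu> / 2 * (1 - t) * (norm (u - v))\<^sup>2) * t"
      by (simp add: algebra_simps)
    with t show "(f (c t) - f u) / t \<le> f v - f u - \<mu> / 2 * (1 - t) * (norm (u - v))\<^sup>2"
      by (simp add: pos_divide_le_eq)
  qed
  moreover have "at (0::real) within {0..1} \<noteq> bot"
    by (simp add: trivial_limit_within islimpt_Icc)
  ultimately have "g \<bullet> (v - u) \<le> f v - f u - \<mu> / 2 * (1 - 0) * (norm (u - v))\<^sup>2"
    using lim tendsto_le by blast
  then show ?thesis by (simp add: norm_minus_commute)
qed

text \<open>Add the convexity and concavity bounds, each in both directions: the values of
  \<open>f\<close> at the four corners \<open>(u, l)\<close>, \<open>(v, l)\<close>,
  \<open>(v, m)\<close>, \<open>(u, m)\<close> cancel. Stated from first-order bounds alone, this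
  serves for a single sample and for expectations.\<close>

lemma saddle_gradient_strongly_monotone:
  fixes f :: "'a::real_inner \<Rightarrow> 'b::real_inner \<Rightarrow> real"
  assumes "\<And>u v l. u \<in> S \<Longrightarrow> v \<in> S \<Longrightarrow> l \<in> T \<Longrightarrow>
      f u l + gy u l \<bullet> (v - u) + \<mu> / 2 * (norm (v - u))\<^sup>2 \<le> f v l"
    and "\<And>u l m. u \<in> S \<Longrightarrow> l \<in> T \<Longrightarrow> m \<in> T \<Longrightarrow>
      f u m \<le> f u l + gl u l \<bullet> (m - l) - \<mu> / 2 * (norm (m - l))\<^sup>2"
    and "u \<in> S" "v \<in> S" "l \<in> T" "m \<in> T"
  shows "\<mu> * (norm ((u, l) - (v, m)))\<^sup>2
      \<le> ((gy u l, - gl u l) - (gy v m, - gl v m)) \<bullet> ((u, l) - (v, m))"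
proof -
  have "(norm ((u, l) - (v, m)))\<^sup>2 = (norm (v - u))\<^sup>2 + (norm (m - l))\<^sup>2"
    by (simp add: norm_Pair norm_minus_commute)
  moreover have "norm (u - v) = norm (v - u)" "norm (l - m) = norm (m - l)"
    by (simp_all add: norm_minus_commute)
  moreover note assms(1)[of u v l] assms(1)[of v u m] assms(2)[of u l m] assms(2)[of v m l] assms(3-)
  ultimately show ?thesis
    by (simp add: inner_diff_left inner_diff_right distrib_left)
qed

section \<open>Projected gradient steps and saddle points\<close>

lemma closest_point_Times:
  fixes A :: "'a::euclidean_space set" and B :: "'b::euclidean_space set"
  assumes "convex A" "closed A" "A \<noteq> {}" "convex B" "closed B" "B \<noteq> {}"
  shows "closest_point (A \<times> B) (a, b) = (closest_point A a, closest_point B b)"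
proof (rule closest_point_unique[symmetric])
  \<comment> \<open>Squared distances in the product add up, so minimizing each summand minimizes
    the sum.\<close>
  show "\<forall>w\<in>A \<times> B. dist (a, b) (closest_point A a, closest_point B b) \<le> dist (a, b) w"
    using assms by (auto simp: dist_Pair_Pair closest_point_le intro!: real_sqrt_le_mono add_mono power_mono)
qed (use assms in \<open>auto simp: convex_Times closed_Times closest_point_in_set\<close>)

text \<open>Expand the square: strong monotonicity controls the cross term and the Lipschitz bound
  the last one. Here \<open>d\<close> stands for a difference of points, \<open>e\<close> for the
  difference of their gradients.\<close>

lemma gradient_step_contraction:
  fixes d e :: "'a::real_inner"
  assumes "\<mu> * (norm d)\<^sup>2 \<le> e \<bullet> d" "norm e \<le> L * norm d" "0 \<le> \<eta>"
  shows "norm (d - \<eta> *\<^sub>R e) \<le> sqrt (1 - 2 * \<eta> * \<mu> + \<eta>\<^sup>2 * L\<^sup>2) * norm d"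
proof -
  have "(norm e)\<^sup>2 \<le> (L * norm d)\<^sup>2"
    using assms(2) by (intro power_mono) auto
  then have "\<eta>\<^sup>2 * (norm e)\<^sup>2 \<le> \<eta>\<^sup>2 * (L * norm d)\<^sup>2"
    by (intro mult_left_mono) auto
  moreover have "2 * \<eta> * (\<mu> * (norm d)\<^sup>2) \<le> 2 * \<eta> * (e \<bullet> d)"
    using assms by (intro mult_left_mono) auto
  moreover have "(norm (d - \<eta> *\<^sub>R e))\<^sup>2 = (norm d)\<^sup>2 - 2 * \<eta> * (e \<bullet> d) + \<eta>\<^sup>2 * (norm e)\<^sup>2"
    unfolding power2_norm_eq_inner
    by (simp add: inner_diff_left inner_diff_right inner_commute power2_eq_square)
  ultimately have "(norm (d - \<eta> *\<^sub>R e))\<^sup>2 \<le> (1 - 2 * \<eta> * \<mu> + \<eta>\<^sup>2 * L\<^sup>2) * (norm d)\<^sup>2"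
    by (simp add: algebra_simps power_mult_distrib)
  then have "sqrt ((norm (d - \<eta> *\<^sub>R e))\<^sup>2) \<le> sqrt ((1 - 2 * \<eta> * \<mu> + \<eta>\<^sup>2 * L\<^sup>2) * (norm d)\<^sup>2)"
    by (rule real_sqrt_le_mono)
  then show ?thesis by (simp add: real_sqrt_mult)
qed

text \<open>Banach's theorem for the projected gradient step yields a saddle point, so no minimax theorem
  is needed; strong convexity and concavity then force the min-max and max-min points to agree with
  it.\<close>

lemma saddle_fixed_point:
  fixes F :: "'a::euclidean_space \<Rightarrow> 'b::euclidean_space \<Rightarrow> real" and \<mu> L \<eta> :: real
  assumes S: "convex S" "compact S" and T: "convex T" "compact T"
    and convex_bound: "\<And>u v l. u \<in> S \<Longrightarrow> v \<in> S \<Longrightarrow> l \<in> T \<Longrightarrow>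
      F u l + gy u l \<bullet> (v - u) + \<mu> / 2 * (norm (v - u))\<^sup>2 \<le> F v l"
    and concave_bound: "\<And>u l m. u \<in> S \<Longrightarrow> l \<in> T \<Longrightarrow> m \<in> T \<Longrightarrow>
      F u m \<le> F u l + gl u l \<bullet> (m - l) - \<mu> / 2 * (norm (m - l))\<^sup>2"
    and lip: "L-lipschitz_on (S \<times> T) (\<lambda>(u, l). (gy u l, - gl u l))"
    and "0 < \<mu>" "0 < \<eta>" and q: "0 \<le> 1 - 2 * \<eta> * \<mu> + \<eta>\<^sup>2 * L\<^sup>2" "1 - 2 * \<eta> * \<mu> + \<eta>\<^sup>2 * L\<^sup>2 < 1"
    and ybar: "is_arg_min (\<lambda>u. SUP l\<in>T. F u l) (\<lambda>u. u \<in> S) ybar"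
    and lbar: "is_arg_max (\<lambda>l. INF u\<in>S. F u l) (\<lambda>l. l \<in> T) lbar"
  shows "closest_point (S \<times> T) ((ybar, lbar) - \<eta> *\<^sub>R (gy ybar lbar, - gl ybar lbar)) = (ybar, lbar)"
proof -
  define K where "K = S \<times> T"
  define G where "G = (\<lambda>(u, l). (gy u l, - gl u l))"
  define q where "q = sqrt (1 - 2 * \<eta> * \<mu> + \<eta>\<^sup>2 * L\<^sup>2)"
  have in_S: "ybar \<in> S" and in_T: "lbar \<in> T"
    using ybar lbar by (auto simp: is_arg_min_def is_arg_max_def)
  have K: "convex K" "closed K" "compact K" "K \<noteq> {}"
    using S T in_S in_T
    by (auto simp: K_def convex_Times closed_Times compact_imp_closed compact_Times)
  have contr: "dist (closest_point K (p - \<eta> *\<^sub>R G p)) (closest_point K (p' - \<eta> *\<^sub>R G p')) \<le> q * dist p p'"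
    if p: "p \<in> K" "p' \<in> K" for p p'
  proof -
    have "dist (closest_point K (p - \<eta> *\<^sub>R G p)) (closest_point K (p' - \<eta> *\<^sub>R G p'))
        \<le> dist (p - \<eta> *\<^sub>R G p) (p' - \<eta> *\<^sub>R G p')"
      by (rule closest_point_lipschitz) (use K in auto)
    also have "\<dots> = norm ((p - p') - \<eta> *\<^sub>R (G p - G p'))"
      by (simp add: dist_norm algebra_simps)
    also have "\<dots> \<le> q * norm (p - p')"
      unfolding q_def
    proof (rule gradient_step_contraction)
      show "\<mu> * (norm (p - p'))\<^sup>2 \<le> (G p - G p') \<bullet> (p - p')"
        using saddle_gradient_strongly_monotone[of S T F gy \<mu> gl, OF convex_bound concave_bound] p
        by (cases p; cases p') (auto simp: K_def G_def)
      show "norm (G p - G p') \<le> L * norm (p - p')"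
        using lipschitz_onD[OF lip, of p p'] p by (auto simp: G_def K_def dist_norm)
    qed (use \<open>0 < \<eta>\<close> in simp)
    finally show ?thesis by (simp add: dist_norm)
  qed
  have "\<exists>!p. p \<in> K \<and> closest_point K (p - \<eta> *\<^sub>R G p) = p"
  proof (rule Banach_fix[OF compact_imp_complete[OF K(3)] K(4), of q])
    show "0 \<le> q" "q < 1" using q by (simp_all add: q_def)
    show "(\<lambda>p. closest_point K (p - \<eta> *\<^sub>R G p)) ` K \<subseteq> K"
      using K closest_point_in_set by (intro image_subsetI) auto
  qed (rule contr)
  then obtain ys ls where ps: "(ys, ls) \<in> K"
      and fix_ps: "closest_point K ((ys, ls) - \<eta> *\<^sub>R G (ys, ls)) = (ys, ls)"
    by (metis surj_pair)
  then have ys: "ys \<in> S" and ls: "ls \<in> T" by (auto simp: K_def)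
  \<comment> \<open>The obtuse-angle property of the projection turns the fixed-point equation,
    divided by \<eta>, into a variational inequality. Varying one coordinate at a time then
    separates it into the minimum in \<open>u\<close> and the maximum in \<open>m\<close>, both with
    quadratic growth.\<close>
  have vi: "0 \<le> G (ys, ls) \<bullet> (w - (ys, ls))" if "w \<in> K" for w
    using closest_point_dot[OF K(1,2) that, of "(ys, ls) - \<eta> *\<^sub>R G (ys, ls)"] fix_ps \<open>0 < \<eta>\<close>
    by (simp add: zero_le_mult_iff)
  have min_ys: "F ys ls + \<mu> / 2 * (norm (u - ys))\<^sup>2 \<le> F u ls" if "u \<in> S" for u
    using vi[of "(u, ls)"] convex_bound[OF ys that ls] that ls by (simp add: K_def G_def)
  have max_ls: "F ys m \<le> F ys ls - \<mu> / 2 * (norm (m - ls))\<^sup>2" if "m \<in> T" for m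
    using vi[of "(ys, m)"] concave_bound[OF ys ls that] that ys by (simp add: K_def G_def)
  \<comment> \<open>Real suprema are only meaningful for bounded families. The first-order bounds
    supply affine majorants and minorants, which are bounded on the compact sets.\<close>
  have above: "bdd_above (F u ` T)" if "u \<in> S" for u
  proof -
    have "bounded ((\<lambda>m. F u ls + gl u ls \<bullet> (m - ls)) ` T)"
      by (intro compact_imp_bounded compact_continuous_image continuous_intros T)
    then obtain C where "\<forall>m\<in>T. norm (F u ls + gl u ls \<bullet> (m - ls)) \<le> C"
      by (auto simp: bounded_iff)
    moreover have "F u m \<le> norm (F u ls + gl u ls \<bullet> (m - ls))" if "m \<in> T" for m
      using concave_bound[OF \<open>u \<in> S\<close> ls that] \<open>0 < \<mu>\<close>
      by (smt (verit) mult_nonneg_nonneg real_norm_def zero_le_power2 divide_nonneg_nonneg)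
    ultimately show ?thesis by (intro bdd_aboveI2[of _ _ C]) (meson order_trans)
  qed
  have below: "bdd_below ((\<lambda>u. F u l) ` S)" if "l \<in> T" for l
  proof -
    have "bounded ((\<lambda>u. F ys l + gy ys l \<bullet> (u - ys)) ` S)"
      by (intro compact_imp_bounded compact_continuous_image continuous_intros S)
    then obtain C where "\<forall>u\<in>S. norm (F ys l + gy ys l \<bullet> (u - ys)) \<le> C"
      by (auto simp: bounded_iff)
    moreover have "- norm (F ys l + gy ys l \<bullet> (u - ys)) \<le> F u l" if "u \<in> S" for u
      using convex_bound[OF ys that \<open>l \<in> T\<close>] \<open>0 < \<mu>\<close>
      by (smt (verit) mult_nonneg_nonneg real_norm_def zero_le_power2 divide_nonneg_nonneg)
    ultimately show ?thesis by (intro bdd_belowI2[of _ "- C"]) (smt (verit))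
  qed
  have pos: "0 \<le> \<mu> / 2 * (norm x)\<^sup>2" for x :: "'c::real_normed_vector"
    using \<open>0 < \<mu>\<close> by simp
  \<comment> \<open>Optimality of \<open>ybar\<close> sandwiches its value at \<open>ls\<close>
    below the saddle value, and the quadratic growth of \<open>min_ys\<close> then forces
    \<open>ybar = ys\<close>. The argument for \<open>lbar\<close> is the mirror image.\<close>
  have "F ybar ls \<le> (SUP l\<in>T. F ybar l)"
    by (rule cSUP_upper[OF ls above[OF in_S]])
  also have "\<dots> \<le> (SUP l\<in>T. F ys l)"
    using ybar ys by (auto simp: is_arg_min_def not_less)
  also have "\<dots> \<le> F ys ls"
  proof (rule cSUP_least)
    show "F ys m \<le> F ys ls" if "m \<in> T" for m
      using max_ls[OF that] pos[of "m - ls"] by linarith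
  qed (use ls in blast)
  finally have "\<mu> / 2 * (norm (ybar - ys))\<^sup>2 \<le> 0"
    using min_ys[OF in_S] by simp
  then have y_eq: "ybar = ys"
    using \<open>0 < \<mu>\<close> by (simp add: mult_le_0_iff)
  have "F ys ls \<le> (INF u\<in>S. F u ls)"
  proof (rule cINF_greatest)
    show "F ys ls \<le> F u ls" if "u \<in> S" for u
      using min_ys[OF that] pos[of "u - ys"] by linarith
  qed (use ys in blast)
  also have "\<dots> \<le> (INF u\<in>S. F u lbar)"
    using lbar ls by (auto simp: is_arg_max_def not_less)
  also have "\<dots> \<le> F ys lbar"
    by (rule cINF_lower[OF below[OF in_T] ys])
  finally have "\<mu> / 2 * (norm (lbar - ls))\<^sup>2 \<le> 0"
    using max_ls[OF in_T] by simp
  then have "lbar = ls"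
    using \<open>0 < \<mu>\<close> by (simp add: mult_le_0_iff)
  with y_eq fix_ps show ?thesis by (simp add: K_def G_def)
qed

section \<open>Expectations, Wasserstein distance and recurrences\<close>

lemma lipschitz_on_compact_integrable:
  fixes g :: "'a::euclidean_space \<Rightarrow> 'b::euclidean_space"
  assumes P: "prob_space P" "sets P = sets (restrict_space borel C)"
    and "compact C" and lip: "L-lipschitz_on C g"
  shows "integrable P g"
proof -
  interpret prob_space P by (rule P)
  have sp: "space P = C"
    using sets_eq_imp_space_eq[OF P(2)] by (simp add: space_restrict_space)
  have cont: "continuous_on C g"
    using lip by (rule lipschitz_on_continuous_on)
  have "g \<in> borel_measurable P"
    using borel_measurable_continuous_on_restrict[OF cont] measurable_cong_sets[OF P(2) refl] by blast
  moreover have "bounded (g ` C)"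
    using \<open>compact C\<close> cont by (intro compact_imp_bounded compact_continuous_image)
  then obtain b where "\<And>z. z \<in> C \<Longrightarrow> norm (g z) \<le> b"
    by (auto simp: bounded_iff)
  ultimately show ?thesis
    by (intro integrable_const_bound[of _ b]) (auto simp: sp)
qed

text \<open>Under any coupling the difference is the integral of
  \<open>g (fst w) - g (snd w)\<close>, whose norm is at most \<open>L\<close> times the transport
  cost. Dividing by \<open>L\<close> gives a lower bound of the infimum in \<open>W1\<close>, so no
  optimal coupling is called for.\<close>

lemma W1_lipschitz_integral_diff:
  fixes g :: "'a::euclidean_space \<Rightarrow> 'b::euclidean_space"
  assumes P: "prob_space P" "sets P = sets (restrict_space borel C)"
    and Q: "prob_space Q" "sets Q = sets (restrict_space borel C)"
    and "compact C" and lip: "L-lipschitz_on C g" and "0 < L" "0 \<le> c"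
    and W: "W1 P Q \<le> ennreal c"
  shows "norm ((\<integral>z. g z \<partial>P) - (\<integral>z. g z \<partial>Q)) \<le> L * c"
proof -
  have sp: "space P = C" "space Q = C"
    using sets_eq_imp_space_eq[OF P(2)] sets_eq_imp_space_eq[OF Q(2)]
    by (simp_all add: space_restrict_space)
  have int: "integrable P g" "integrable Q g"
    using assms by (auto intro: lipschitz_on_compact_integrable)
  let ?d = "norm ((\<integral>z. g z \<partial>P) - (\<integral>z. g z \<partial>Q))"
  have "ennreal (?d / L) \<le> W1 P Q"
    unfolding W1_def
  proof (rule INF_greatest)
    fix G assume "G \<in> couplings P Q"
    then have sG: "sets G = sets (P \<Otimes>\<^sub>M Q)" and dP: "distr G P fst = P" and dQ: "distr G Q snd = Q"
      by (auto simp: couplings_def)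
    have spG: "space G = C \<times> C"
      using sets_eq_imp_space_eq[OF sG] by (simp add: space_pair_measure sp)
    have m: "fst \<in> measurable G P" "snd \<in> measurable G Q"
      unfolding measurable_cong_sets[OF sG refl] by simp_all
    have i1: "integrable G (\<lambda>w. g (fst w))"
      using integrable_distr[OF m(1), of g] int by (simp add: dP)
    have i2: "integrable G (\<lambda>w. g (snd w))"
      using integrable_distr[OF m(2), of g] int by (simp add: dQ)
    have e1: "(\<integral>z. g z \<partial>P) = (\<integral>w. g (fst w) \<partial>G)"
      using integral_distr[OF m(1), of g] int by (simp add: dP)
    have e2: "(\<integral>z. g z \<partial>Q) = (\<integral>w. g (snd w) \<partial>G)"
      using integral_distr[OF m(2), of g] int by (simp add: dQ)
    have "?d = norm (\<integral>w. g (fst w) - g (snd w) \<partial>G)"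
      using i1 i2 by (simp add: e1 e2)
    also have "\<dots> \<le> (\<integral>w. norm (g (fst w) - g (snd w)) \<partial>G)"
      by (rule integral_norm_bound)
    finally have "?d / L \<le> (\<integral>w. norm (g (fst w) - g (snd w)) / L \<partial>G)"
      using \<open>0 < L\<close> by (simp add: divide_right_mono)
    then have "ennreal (?d / L) \<le> ennreal (\<integral>w. norm (g (fst w) - g (snd w)) / L \<partial>G)"
      by (rule ennreal_leI)
    also have "\<dots> = (\<integral>\<^sup>+ w. ennreal (norm (g (fst w) - g (snd w)) / L) \<partial>G)"
      using i1 i2 \<open>0 < L\<close> by (intro nn_integral_eq_integral[symmetric]) auto
    also have "\<dots> \<le> (\<integral>\<^sup>+ w. ennreal (dist (fst w) (snd w)) \<partial>G)"
    proof (intro nn_integral_mono ennreal_leI)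
      fix w assume "w \<in> space G"
      then have "norm (g (fst w) - g (snd w)) \<le> L * dist (fst w) (snd w)"
        using lipschitz_onD[OF lip, of "fst w" "snd w"] by (auto simp: spG dist_norm)
      then show "norm (g (fst w) - g (snd w)) / L \<le> dist (fst w) (snd w)"
        using \<open>0 < L\<close> by (simp add: divide_le_eq mult.commute)
    qed
    finally show "ennreal (?d / L) \<le> (\<integral>\<^sup>+ w. ennreal (dist (fst w) (snd w)) \<partial>G)" .
  qed
  also note W
  finally show ?thesis
    using \<open>0 < L\<close> \<open>0 \<le> c\<close> by (simp add: divide_le_eq mult.commute)
qed

text \<open>The number \<open>c / (1 - \<rho>)\<close> is the fixed point of the affine map; the
  excess over it is bounded by a geometric sequence. Since \<rho> is nonnegative the map is
  monotone, which carries the induction.\<close>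

lemma limsup_affine_recurrence:
  fixes e :: "nat \<Rightarrow> real"
  assumes step: "\<And>k. e (Suc k) \<le> \<rho> * e k + c" and "0 \<le> \<rho>" "\<rho> < 1"
  shows "limsup (\<lambda>k. ereal (e k)) \<le> ereal (c / (1 - \<rho>))"
proof -
  have bound: "e k \<le> \<rho> ^ k * (e 0 - c / (1 - \<rho>)) + c / (1 - \<rho>)" for k
  proof (induction k)
    case (Suc k)
    have "e (Suc k) \<le> \<rho> * (\<rho> ^ k * (e 0 - c / (1 - \<rho>)) + c / (1 - \<rho>)) + c"
      using step[of k] mult_left_mono[OF Suc \<open>0 \<le> \<rho>\<close>] by linarith
    also have "\<dots> = \<rho> ^ Suc k * (e 0 - c / (1 - \<rho>)) + (\<rho> * (c / (1 - \<rho>)) + c)"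
      by (simp add: algebra_simps)
    also have "\<rho> * (c / (1 - \<rho>)) + c = c / (1 - \<rho>)"
      using \<open>\<rho> < 1\<close> by (simp add: field_simps)
    finally show ?case .
  qed simp
  have "(\<lambda>k. \<rho> ^ k * (e 0 - c / (1 - \<rho>)) + c / (1 - \<rho>)) \<longlonglongrightarrow> 0 * (e 0 - c / (1 - \<rho>)) + c / (1 - \<rho>)"
    using assms by (intro tendsto_intros LIMSEQ_power_zero) auto
  then have "limsup (\<lambda>k. ereal (\<rho> ^ k * (e 0 - c / (1 - \<rho>)) + c / (1 - \<rho>))) = ereal (c / (1 - \<rho>))"
    by (intro lim_imp_Limsup) auto
  then show ?thesis
    using Limsup_mono[of "\<lambda>k. ereal (e k)" _ sequentially] bound
    by (metis (mono_tags, lifting) always_eventually ereal_less_eq(3))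
qed

lemma compact_cube: "compact (cube :: (real ^ 'n::finite) set)"
proof -
  have "(cube :: (real ^ 'n) set) = cbox (\<chi> i. -1) (\<chi> i. 1)"
    by (auto simp: cube_def mem_box_cart)
  then show ?thesis by (metis compact_cbox)
qed

theorem theorem2:
  fixes \<phi> :: "'n::finite decision \<Rightarrow> real ^ 'm::finite \<Rightarrow> real ^ 'n \<Rightarrow> real"
    and D Dms :: "'n decision \<Rightarrow> (real ^ 'n) measure"
    and trunc :: "real measure \<Rightarrow> real measure"
    and \<Psi> :: "'n \<Rightarrow> real \<Rightarrow> real \<Rightarrow> real"
    and N :: "'n \<Rightarrow> real measure"
    and YY :: "'n decision set" and MM :: "(real ^ 'm) set"
    and \<mu> L \<epsilon> B \<eta> :: real
    and pbar :: "'n decision \<times> (real ^ 'm)"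
    and y :: "nat \<Rightarrow> 'n decision" and l :: "nat \<Rightarrow> real ^ 'm"
  assumes YY: "YY \<subseteq> decision_space" "YY \<noteq> {}" "convex YY" "compact YY"
    and MM: "MM \<subseteq> nonneg_orthant" "MM \<noteq> {}" "convex MM" "compact MM"
    and constants: "0 < \<mu>" "0 < L" "0 \<le> \<epsilon>" "0 \<le> B"
    and true_map: "distribution_map D"
    and model_map: "trunc = saturate_law \<or> trunc = condition_law" "user_model trunc \<Psi> N Dms"
    and \<Psi>_lipschitz:
      "\<epsilon>-lipschitz_on decision_space (\<lambda>(x, \<beta>). \<chi> i. \<Psi> i (x $ i) (\<beta> $ i))"
    and expectations_exist:
      "\<And>y' y l. y' \<in> YY \<Longrightarrow> y \<in> YY \<Longrightarrow> l \<in> MM \<Longrightarrow> integrable (D y') (\<lambda>z. \<phi> y l z)"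
    and smooth:
      "\<And>z. z \<in> cube \<Longrightarrow>
        continuously_differentiable_on (\<lambda>(y, l). \<phi> y l z) (decision_space \<times> nonneg_orthant)"
    and strongly_convex:
      "\<And>z l. z \<in> cube \<Longrightarrow> l \<in> nonneg_orthant \<Longrightarrow>
        strongly_convex_on \<mu> decision_space (\<lambda>y. \<phi> y l z)"
    and strongly_concave:
      "\<And>z y. z \<in> cube \<Longrightarrow> y \<in> decision_space \<Longrightarrow>
        strongly_concave_on \<mu> nonneg_orthant (\<lambda>l. \<phi> y l z)"
    and gradient_lipschitz_p:
      "\<And>z. z \<in> cube \<Longrightarrow>
        L-lipschitz_on (decision_space \<times> nonneg_orthant)
          (\<lambda>(y, l). stochastic_gradient_map \<phi> y l z)"
    and gradient_lipschitz_z: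
      "\<And>y l. y \<in> decision_space \<Longrightarrow> l \<in> nonneg_orthant \<Longrightarrow>
        L-lipschitz_on cube (\<lambda>z. stochastic_gradient_map \<phi> y l z)"
    and D_lipschitz:
      "\<And>y y'. y \<in> decision_space \<Longrightarrow> y' \<in> decision_space \<Longrightarrow>
        W1 (D y) (D y') \<le> ennreal (\<epsilon> * norm (y - y'))"
    and misspecified: "\<And>y. y \<in> YY \<Longrightarrow> W1 (Dms y) (D y) \<le> ennreal B"
    and contraction: "\<epsilon> * L / \<mu> < 1"
    and step_size: "\<eta> \<in> {0 <..< 2 * (\<mu> - \<epsilon> * L) / (L\<^sup>2 * (1 - \<epsilon>\<^sup>2))}"
    and equilibrium: "equilibrium_point \<phi> D YY MM pbar"
    and start: "y 0 \<in> YY" "l 0 \<in> MM"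
    and y_step:
      "\<And>k. y (Suc k) =
        closest_point YY (y k - \<eta> *\<^sub>R (\<integral>z. grad_y \<phi> (y k) (l k) z \<partial>Dms (y k)))"
    and l_step:
      "\<And>k. l (Suc k) =
        closest_point MM (l k + \<eta> *\<^sub>R (\<integral>z. grad_lambda \<phi> (y k) (l k) z \<partial>Dms (y k)))"
  shows "let \<rho> = sqrt (1 - 2 * \<eta> * \<mu> + \<eta>\<^sup>2 * L\<^sup>2) + \<eta> * \<epsilon> * L in
    \<rho> < 1 \<and>
    limsup (\<lambda>k. ereal (norm ((y k, l k) - pbar))) \<le> ereal (sqrt 2 * \<eta> * L * B / (1 - \<rho>))"
proof -

  \<comment> \<open>Notation and integrability\<close>
  let ?S = "decision_space :: 'n decision set" and ?T = "nonneg_orthant :: (real ^ 'm) set"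
  define K where "K = YY \<times> MM"
  define \<psi> where "\<psi> p z = stochastic_gradient_map \<phi> (fst p) (snd p) z" for p z
  \<comment> \<open>Law and point are separate arguments, so that the law can stay frozen while the
    point moves.\<close>
  define E where "E P p = (\<integral>z. \<psi> p z \<partial>P)" for P p
  define law where "law P \<longleftrightarrow> prob_space P \<and> sets P = sets (restrict_space borel (cube :: (real ^ 'n) set))" for P
  define q where "q = sqrt (1 - 2 * \<eta> * \<mu> + \<eta>\<^sup>2 * L\<^sup>2)"
  define p where "p k = (y k, l k)" for k
  obtain ybar lbar where pbar: "pbar = (ybar, lbar)" by (cases pbar)
  have ybar: "is_arg_min (\<lambda>u. SUP l\<in>MM. \<integral>z. \<phi> u l z \<partial>D ybar) (\<lambda>u. u \<in> YY) ybar"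
    and lbar: "is_arg_max (\<lambda>l. INF u\<in>YY. \<integral>z. \<phi> u l z \<partial>D ybar) (\<lambda>l. l \<in> MM) lbar"
    using equilibrium by (simp_all add: equilibrium_point_def pbar)
  have ybar_in: "ybar \<in> YY" and lbar_in: "lbar \<in> MM"
    using ybar lbar by (auto simp: is_arg_min_def is_arg_max_def)
  have K: "convex K" "closed K" "K \<noteq> {}" "K \<subseteq> ?S \<times> ?T"
    using YY MM by (auto simp: K_def convex_Times closed_Times compact_imp_closed)
  have law_D: "law (D u)" if "u \<in> YY" for u
    using true_map that YY(1) by (auto simp: law_def distribution_map_def)
  have law_Dms: "law (Dms u)" if "u \<in> YY" for u
    using model_map(2) that YY(1) by (auto simp: law_def user_model_def distribution_map_def)
  have space_law: "space P = cube" if "law P" for P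
    using that sets_eq_imp_space_eq[of P "restrict_space borel cube"]
    by (simp add: law_def space_restrict_space)
  have \<psi>_lip_p: "norm (\<psi> p z - \<psi> p' z) \<le> L * norm (p - p')"
    if "p \<in> ?S \<times> ?T" "p' \<in> ?S \<times> ?T" "z \<in> cube" for p p' z
    using lipschitz_onD[OF gradient_lipschitz_p[OF that(3)] that(1,2)]
    by (simp add: \<psi>_def dist_norm split_beta)
  have \<psi>_lip_z: "L-lipschitz_on cube (\<psi> p)" if "p \<in> ?S \<times> ?T" for p
    using gradient_lipschitz_z that unfolding \<psi>_def by auto
  have \<psi>_int: "integrable P (\<psi> p)" if "law P" "p \<in> ?S \<times> ?T" for P p
    using lipschitz_on_compact_integrable[OF _ _ compact_cube \<psi>_lip_z] that by (simp add: law_def)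
  have grad_int: "integrable P (grad_y \<phi> u m)" "integrable P (grad_lambda \<phi> u m)"
    and E_eq: "E P (u, m) = (integral\<^sup>L P (grad_y \<phi> u m), - integral\<^sup>L P (grad_lambda \<phi> u m))"
    if "law P" "u \<in> ?S" "m \<in> ?T" for P u m
  proof -
    have i: "integrable P (\<psi> (u, m))"
      using \<psi>_int that by simp
    have 1: "fst (\<psi> (u, m) z) = grad_y \<phi> u m z" "- snd (\<psi> (u, m) z) = grad_lambda \<phi> u m z" for z
      by (simp_all add: \<psi>_def stochastic_gradient_map_def)
    \<comment> \<open>The negation undoes the sign in the second component of \<psi>.\<close>
    have bl: "bounded_linear (\<lambda>x :: 'n decision \<times> (real ^ 'm). - snd x)"
      by (intro bounded_linear_minus bounded_linear_snd)
    show "integrable P (grad_y \<phi> u m)"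
      using integrable_bounded_linear[OF bounded_linear_fst i] by (simp add: 1)
    show "integrable P (grad_lambda \<phi> u m)"
      using integrable_bounded_linear[OF bl i] by (simp add: 1)
    show "E P (u, m) = (integral\<^sup>L P (grad_y \<phi> u m), - integral\<^sup>L P (grad_lambda \<phi> u m))"
      using integral_bounded_linear[OF bounded_linear_fst i] integral_bounded_linear[OF bl i]
      by (simp add: 1 E_def prod_eq_iff)
  qed

  \<comment> \<open>First-order bounds for each sample\<close>
  have convex_bound: "\<phi> u m z + grad_y \<phi> u m z \<bullet> (v - u) + \<mu> / 2 * (norm (v - u))\<^sup>2 \<le> \<phi> v m z"
    if "u \<in> ?S" "v \<in> ?S" "m \<in> ?T" "z \<in> cube" for u v m z
  proof (rule strongly_convex_on_first_order[OF strongly_convex[OF that(4,3)] that(1,2)])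
    \<comment> \<open>Smoothness is joint in both variables while \<open>grad_y\<close> lives on a
      slice; the chain rule through \<open>v \<mapsto> (v, m)\<close> connects the two.\<close>
    have "(\<lambda>(y, l). \<phi> y l z) differentiable (at (u, m) within (\<lambda>v. (v, m)) ` ?S)"
      using smooth[OF that(4)] that(1,3)
      unfolding continuously_differentiable_on_def differentiable_on_def
      by (auto intro: differentiable_within_subset)
    moreover have "(\<lambda>v. (v, m)) differentiable (at u within ?S)"
      unfolding differentiable_def by (auto intro!: derivative_eq_intros)
    ultimately have "(\<lambda>v. \<phi> v m z) differentiable (at u within ?S)"
      using differentiable_chain_within[of "\<lambda>v. (v, m)" u ?S "\<lambda>(y, l). \<phi> y l z"]
      by (simp add: o_def)
    then show "((\<lambda>v. \<phi> v m z) has_derivative (\<lambda>h. grad_y \<phi> u m z \<bullet> h)) (at u within ?S)"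
      unfolding grad_y_def by (rule has_derivative_gradient_on)
  qed
  have concave_bound: "\<phi> u r z \<le> \<phi> u m z + grad_lambda \<phi> u m z \<bullet> (r - m) - \<mu> / 2 * (norm (r - m))\<^sup>2"
    if "u \<in> ?S" "m \<in> ?T" "r \<in> ?T" "z \<in> cube" for u m r z
  proof -
    have "(\<lambda>(y, l). \<phi> y l z) differentiable (at (u, m) within (\<lambda>r. (u, r)) ` ?T)"
      using smooth[OF that(4)] that(1,2)
      unfolding continuously_differentiable_on_def differentiable_on_def
      by (auto intro: differentiable_within_subset)
    moreover have "(\<lambda>r. (u, r)) differentiable (at m within ?T)"
      unfolding differentiable_def by (auto intro!: derivative_eq_intros)
    ultimately have "(\<lambda>r. \<phi> u r z) differentiable (at m within ?T)"
      using differentiable_chain_within[of "\<lambda>r. (u, r)" m ?T "\<lambda>(y, l). \<phi> y l z"]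
      by (simp add: o_def)
    then have "((\<lambda>r. \<phi> u r z) has_derivative (\<lambda>h. grad_lambda \<phi> u m z \<bullet> h)) (at m within ?T)"
      unfolding grad_lambda_def by (rule has_derivative_gradient_on)
    then have "((\<lambda>r. - \<phi> u r z) has_derivative (\<lambda>h. - grad_lambda \<phi> u m z \<bullet> h)) (at m within ?T)"
      by (auto intro!: derivative_eq_intros)
    from strongly_convex_on_first_order[OF _ that(2,3) this]
      strongly_concave[OF that(4,1)] show ?thesis
      by (fastforce simp: strongly_concave_on_def)
  qed

  \<comment> \<open>Step size and contraction factor\<close>
  have "\<mu> \<le> L"
  proof -
    \<comment> \<open>Comparing strong monotonicity with the Lipschitz bound at two distinct points
      gives \<mu> \<le> L. This yields \<epsilon> < 1 and a nonnegative radicand below.\<close>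
    define p0 :: "'n decision \<times> (real ^ 'm)" where "p0 = ((0, 0), 0)"
    define p1 :: "'n decision \<times> (real ^ 'm)" where "p1 = ((1, 0), 0)"
    have in_ST: "p0 \<in> ?S \<times> ?T" "p1 \<in> ?S \<times> ?T" "(0 :: real ^ 'n) \<in> cube"
      by (auto simp: p0_def p1_def decision_space_def nonneg_orthant_def cube_def)
    have nz: "0 < norm (p1 - p0)"
      by (simp add: p0_def p1_def)
    have "\<mu> * (norm (p1 - p0))\<^sup>2 \<le> (\<psi> p1 0 - \<psi> p0 0) \<bullet> (p1 - p0)"
      using saddle_gradient_strongly_monotone[of ?S ?T "\<lambda>u m. \<phi> u m 0" "\<lambda>u m. grad_y \<phi> u m 0" \<mu>
          "\<lambda>u m. grad_lambda \<phi> u m 0" "fst p1" "fst p0" "snd p1" "snd p0"]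
        convex_bound concave_bound in_ST
      by (simp add: \<psi>_def stochastic_gradient_map_def mem_Times_iff)
    also have "\<dots> \<le> norm (\<psi> p1 0 - \<psi> p0 0) * norm (p1 - p0)"
      by (rule norm_cauchy_schwarz)
    also have "\<dots> \<le> (L * norm (p1 - p0)) * norm (p1 - p0)"
      using \<psi>_lip_p in_ST by (intro mult_right_mono) auto
    finally show ?thesis
      using nz by (simp add: power2_eq_square mult.assoc[symmetric])
  qed
  have \<epsilon>L: "\<epsilon> * L < \<mu>"
    using contraction constants by (simp add: divide_less_eq)
  then have "\<epsilon> * L < 1 * L"
    using \<open>\<mu> \<le> L\<close> by simp
  then have "\<epsilon> < 1"
    using constants(2) by (simp only: mult_less_cancel_right_pos)
  have \<eta>: "0 < \<eta>" "\<eta> * (L\<^sup>2 * (1 - \<epsilon>\<^sup>2)) < 2 * (\<mu> - \<epsilon> * L)"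
  proof -
    \<comment> \<open>The denominator of the step-size bound must be positive before it can be
      cleared.\<close>
    have "\<epsilon>\<^sup>2 < 1"
      using \<open>\<epsilon> < 1\<close> constants(3) by (simp add: power_less_one_iff abs_square_less_1)
    then have "0 < L\<^sup>2 * (1 - \<epsilon>\<^sup>2)"
      using constants by simp
    then show "\<eta> * (L\<^sup>2 * (1 - \<epsilon>\<^sup>2)) < 2 * (\<mu> - \<epsilon> * L)"
      using step_size by (simp add: pos_less_divide_eq)
  qed (use step_size in simp)
  have nonneg: "0 \<le> 1 - 2 * \<eta> * \<mu> + \<eta>\<^sup>2 * L\<^sup>2"
  proof -
    \<comment> \<open>By \<mu> \<le> L the radicand is at least the square of
      \<open>1 - \<eta> * L\<close>.\<close>
    have "\<eta> * \<mu> \<le> \<eta> * L" using \<open>\<mu> \<le> L\<close> \<eta>(1) by simp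
    moreover have "0 \<le> (1 - \<eta> * L)\<^sup>2" by simp
    ultimately show ?thesis by (simp add: power2_eq_square algebra_simps)
  qed
  have "\<eta> * \<epsilon> * L < 1"
  proof -
    \<comment> \<open>Factor \<open>1 - \<epsilon>\<^sup>2\<close>, use \<mu> \<le> L on the right
      and cancel \<open>L * (1 - \<epsilon>)\<close>. The outcome makes
      \<open>1 - \<eta> * \<epsilon> * L\<close> positive, so that the inequality for
      \<open>q\<close> may be squared.\<close>
    have "(\<eta> * L * (1 + \<epsilon>)) * (L * (1 - \<epsilon>)) < 2 * (\<mu> - \<epsilon> * L)"
      using \<eta>(2) by (simp add: power2_eq_square algebra_simps)
    also have "\<dots> \<le> 2 * (L * (1 - \<epsilon>))"
      using \<open>\<mu> \<le> L\<close> by (simp add: algebra_simps)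
    finally have "\<eta> * L * (1 + \<epsilon>) < 2"
      using \<open>\<epsilon> < 1\<close> constants by (simp only: mult_less_cancel_right_pos mult_pos_pos diff_gt_0_iff_gt)
    moreover have "\<eta> * L * \<epsilon> \<le> \<eta> * L * 1"
      using \<open>\<epsilon> < 1\<close> constants \<eta>(1) by (intro mult_left_mono) auto
    ultimately show ?thesis by (simp add: algebra_simps)
  qed
  have "q < 1 - \<eta> * \<epsilon> * L"
    unfolding q_def
  proof (rule real_less_lsqrt)
    \<comment> \<open>The squared inequality is exactly the step-size condition multiplied by
      \<eta>.\<close>
    have "\<eta> * (\<eta> * (L\<^sup>2 * (1 - \<epsilon>\<^sup>2))) < \<eta> * (2 * (\<mu> - \<epsilon> * L))"
      using \<eta> by simp
    then show "1 - 2 * \<eta> * \<mu> + \<eta>\<^sup>2 * L\<^sup>2 < (1 - \<eta> * \<epsilon> * L)\<^sup>2"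
      by (simp add: power2_eq_square algebra_simps)
  qed (use \<open>\<eta> * \<epsilon> * L < 1\<close> in simp)
  then have \<rho>: "q + \<eta> * \<epsilon> * L < 1" by simp
  have \<eta>\<epsilon>L: "0 \<le> \<eta> * \<epsilon> * L" using \<eta>(1) constants by simp
  have "0 \<le> q" using nonneg by (simp add: q_def)
  have "q < 1" using \<rho> \<eta>\<epsilon>L by simp

  \<comment> \<open>Expected objective and gradient under fixed laws\<close>
  have E_convex: "(\<integral>z. \<phi> u m z \<partial>D ybar) + integral\<^sup>L (D ybar) (grad_y \<phi> u m) \<bullet> (v - u)
      + \<mu> / 2 * (norm (v - u))\<^sup>2 \<le> (\<integral>z. \<phi> v m z \<partial>D ybar)"
    if "u \<in> YY" "v \<in> YY" "m \<in> MM" for u v m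
  proof -
    interpret prob_space "D ybar" using law_D[OF ybar_in] by (simp add: law_def)
    have ST: "u \<in> ?S" "v \<in> ?S" "m \<in> ?T" using that YY(1) MM(1) by auto
    note int = expectations_exist[OF ybar_in that(1,3)] expectations_exist[OF ybar_in that(2,3)]
      grad_int(1)[OF law_D[OF ybar_in] ST(1,3)]
    \<comment> \<open>Integrating the sample bound leaves the quadratic term unchanged because the
      law has mass 1.\<close>
    have "(\<integral>z. \<phi> u m z + grad_y \<phi> u m z \<bullet> (v - u) + \<mu> / 2 * (norm (v - u))\<^sup>2 \<partial>D ybar)
        \<le> (\<integral>z. \<phi> v m z \<partial>D ybar)"
      using int convex_bound[OF ST] space_law[OF law_D[OF ybar_in]] by (intro integral_mono) auto
    then show ?thesis using int by (simp add: prob_space)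
  qed
  have E_concave: "(\<integral>z. \<phi> u r z \<partial>D ybar) \<le> (\<integral>z. \<phi> u m z \<partial>D ybar)
      + integral\<^sup>L (D ybar) (grad_lambda \<phi> u m) \<bullet> (r - m) - \<mu> / 2 * (norm (r - m))\<^sup>2"
    if "u \<in> YY" "m \<in> MM" "r \<in> MM" for u m r
  proof -
    interpret prob_space "D ybar" using law_D[OF ybar_in] by (simp add: law_def)
    have ST: "u \<in> ?S" "m \<in> ?T" "r \<in> ?T" using that YY(1) MM(1) by auto
    note int = expectations_exist[OF ybar_in that(1,2)] expectations_exist[OF ybar_in that(1,3)]
      grad_int(2)[OF law_D[OF ybar_in] ST(1,2)]
    have "(\<integral>z. \<phi> u r z \<partial>D ybar)
        \<le> (\<integral>z. \<phi> u m z + grad_lambda \<phi> u m z \<bullet> (r - m) - \<mu> / 2 * (norm (r - m))\<^sup>2 \<partial>D ybar)"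
      using int concave_bound[OF ST] space_law[OF law_D[OF ybar_in]] by (intro integral_mono) auto
    then show ?thesis using int by (simp add: prob_space)
  qed
  have E_lip: "norm (E P p - E P p') \<le> L * norm (p - p')" if "law P" "p \<in> K" "p' \<in> K" for P p p'
  proof -
    interpret prob_space P using that by (simp add: law_def)
    have ST: "p \<in> ?S \<times> ?T" "p' \<in> ?S \<times> ?T" using that K(4) by auto
    note int = \<psi>_int[OF \<open>law P\<close> ST(1)] \<psi>_int[OF \<open>law P\<close> ST(2)]
    have "norm (E P p - E P p') = norm (\<integral>z. \<psi> p z - \<psi> p' z \<partial>P)"
      using int by (simp add: E_def)
    also have "\<dots> \<le> (\<integral>z. norm (\<psi> p z - \<psi> p' z) \<partial>P)"
      by (rule integral_norm_bound)
    also have "\<dots> \<le> (\<integral>z. L * norm (p - p') \<partial>P)"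
      using int \<psi>_lip_p[OF ST] space_law[OF \<open>law P\<close>] by (intro integral_mono) auto
    finally show ?thesis by (simp add: prob_space)
  qed
  \<comment> \<open>One point under two laws: this covers both the shift from \<open>D ybar\<close>
    to \<open>D (y k)\<close> and the model error.\<close>
  have E_W1: "norm (E P p - E Q p) \<le> L * c"
    if "law P" "law Q" "p \<in> K" "0 \<le> c" "W1 P Q \<le> ennreal c" for P Q p c
    unfolding E_def using that K(4) constants(2)
    by (intro W1_lipschitz_integral_diff[OF _ _ _ _ compact_cube \<psi>_lip_z]) (auto simp: law_def)
  have E_mono: "\<mu> * (norm (p - p'))\<^sup>2 \<le> (E (D ybar) p - E (D ybar) p') \<bullet> (p - p')"
    if "p \<in> K" "p' \<in> K" for p p'
  proof -
    have "fst p \<in> YY" "fst p' \<in> YY" "snd p \<in> MM" "snd p' \<in> MM"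
      using that by (auto simp: K_def)
    moreover from this have "fst p \<in> ?S" "fst p' \<in> ?S" "snd p \<in> ?T" "snd p' \<in> ?T"
      using YY(1) MM(1) by auto
    ultimately show ?thesis
      using saddle_gradient_strongly_monotone[of YY MM "\<lambda>u m. \<integral>z. \<phi> u m z \<partial>D ybar"
          "\<lambda>u m. integral\<^sup>L (D ybar) (grad_y \<phi> u m)" \<mu>
          "\<lambda>u m. integral\<^sup>L (D ybar) (grad_lambda \<phi> u m)" "fst p" "fst p'" "snd p" "snd p'"]
        E_convex E_concave E_eq[OF law_D[OF ybar_in], of "fst p" "snd p"]
        E_eq[OF law_D[OF ybar_in], of "fst p'" "snd p'"]
      by simp
  qed

  \<comment> \<open>Equilibrium as fixed point, and the error recurrence\<close>
  have pbar_in: "pbar \<in> K" using ybar_in lbar_in by (simp add: pbar K_def)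
  have fixed: "closest_point K (pbar - \<eta> *\<^sub>R E (D ybar) pbar) = pbar"
  proof -
    have "L-lipschitz_on (YY \<times> MM)
        (\<lambda>(u, m). (integral\<^sup>L (D ybar) (grad_y \<phi> u m), - integral\<^sup>L (D ybar) (grad_lambda \<phi> u m)))"
    proof (rule lipschitz_onI)
      fix p p' assume "p \<in> YY \<times> MM" "p' \<in> YY \<times> MM"
      then show "dist (case p of (u, m) \<Rightarrow> (integral\<^sup>L (D ybar) (grad_y \<phi> u m), - integral\<^sup>L (D ybar) (grad_lambda \<phi> u m)))
          (case p' of (u, m) \<Rightarrow> (integral\<^sup>L (D ybar) (grad_y \<phi> u m), - integral\<^sup>L (D ybar) (grad_lambda \<phi> u m)))
          \<le> L * dist p p'"
        using E_lip[OF law_D[OF ybar_in], of p p'] E_eq[OF law_D[OF ybar_in]] YY(1) MM(1)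
        by (auto simp: K_def dist_norm subset_iff)
    qed (use constants in simp)
    moreover have "1 - 2 * \<eta> * \<mu> + \<eta>\<^sup>2 * L\<^sup>2 < 1"
      using \<open>q < 1\<close> by (simp add: q_def)
    ultimately show ?thesis
      using saddle_fixed_point[OF YY(3,4) MM(3,4) E_convex E_concave _ constants(1) \<eta>(1) nonneg _ ybar lbar]
        E_eq[OF law_D[OF ybar_in] subsetD[OF YY(1) ybar_in] subsetD[OF MM(1) lbar_in]]
      by (simp add: K_def pbar)
  qed
  have p_in: "p k \<in> K" for k
    using start y_step l_step YY MM
    by (cases k) (auto simp: p_def K_def closest_point_in_set compact_imp_closed)
  \<comment> \<open>The projection onto a product splits, and the sign in \<psi> turns ascent in the
    multiplier into descent, so both updates form one projected step.\<close>
  have p_step: "p (Suc k) = closest_point K (p k - \<eta> *\<^sub>R E (Dms (y k)) (p k))" for k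
  proof -
    have "y k \<in> YY" "l k \<in> MM" using p_in[of k] by (auto simp: p_def K_def)
    with E_eq[OF law_Dms subsetD[OF YY(1)] subsetD[OF MM(1)]] show ?thesis
      using YY MM by (simp add: p_def K_def y_step l_step closest_point_Times compact_imp_closed)
  qed
  have "norm (p (Suc k) - pbar) \<le> (q + \<eta> * \<epsilon> * L) * norm (p k - pbar) + \<eta> * L * B" for k
  proof -
    have yk: "y k \<in> YY" using p_in[of k] by (auto simp: p_def K_def)
    let ?ms = "E (Dms (y k)) (p k)" and ?Dk = "E (D (y k)) (p k)"
      and ?Db = "E (D ybar) (p k)" and ?b = "E (D ybar) pbar"
    have "norm (p (Suc k) - pbar) \<le> norm ((p k - \<eta> *\<^sub>R ?ms) - (pbar - \<eta> *\<^sub>R ?b))"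
      using closest_point_lipschitz[OF K(1-3), of "p k - \<eta> *\<^sub>R ?ms" "pbar - \<eta> *\<^sub>R ?b"]
      by (simp add: p_step fixed dist_norm)
    also have "(p k - \<eta> *\<^sub>R ?ms) - (pbar - \<eta> *\<^sub>R ?b)
        = ((p k - pbar) - \<eta> *\<^sub>R (?Db - ?b)) - \<eta> *\<^sub>R (?Dk - ?Db) - \<eta> *\<^sub>R (?ms - ?Dk)"
      by (simp add: algebra_simps)
    also have "norm \<dots> \<le> norm ((p k - pbar) - \<eta> *\<^sub>R (?Db - ?b)) + \<eta> * norm (?Dk - ?Db) + \<eta> * norm (?ms - ?Dk)"
      using \<eta>(1) norm_triangle_ineq4[of "((p k - pbar) - \<eta> *\<^sub>R (?Db - ?b)) - \<eta> *\<^sub>R (?Dk - ?Db)" "\<eta> *\<^sub>R (?ms - ?Dk)"]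
        norm_triangle_ineq4[of "(p k - pbar) - \<eta> *\<^sub>R (?Db - ?b)" "\<eta> *\<^sub>R (?Dk - ?Db)"]
      by simp
    also have "\<dots> \<le> q * norm (p k - pbar) + \<eta> * (L * (\<epsilon> * norm (p k - pbar))) + \<eta> * (L * B)"
    proof (intro add_mono mult_left_mono)
      show "norm ((p k - pbar) - \<eta> *\<^sub>R (?Db - ?b)) \<le> q * norm (p k - pbar)"
        unfolding q_def using E_mono E_lip law_D[OF ybar_in] p_in pbar_in \<eta>(1)
        by (intro gradient_step_contraction) auto
      have "norm (?Dk - ?Db) \<le> L * (\<epsilon> * norm (y k - ybar))"
        using D_lipschitz[OF subsetD[OF YY(1) yk] subsetD[OF YY(1) ybar_in]]
          law_D[OF yk] law_D[OF ybar_in] p_in constants(3) by (intro E_W1) simp_all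
      \<comment> \<open>Laws depend on the decision only, whose error is at most that of the
        pair.\<close>
      also have "\<dots> \<le> L * (\<epsilon> * norm (p k - pbar))"
        using constants norm_fst_le[of "y k - ybar" "l k - lbar"]
        by (intro mult_left_mono) (auto simp: p_def pbar)
      finally show "norm (?Dk - ?Db) \<le> L * (\<epsilon> * norm (p k - pbar))" .
      show "norm (?ms - ?Dk) \<le> L * B"
        using misspecified[OF yk] law_D[OF yk] law_Dms[OF yk] p_in constants(4) by (intro E_W1) simp_all
    qed (use \<eta>(1) in auto)
    finally show ?thesis by (simp add: algebra_simps)
  qed
  then have "limsup (\<lambda>k. ereal (norm (p k - pbar))) \<le> ereal (\<eta> * L * B / (1 - (q + \<eta> * \<epsilon> * L)))"
    by (rule limsup_affine_recurrence) (use \<rho> \<eta>\<epsilon>L \<open>0 \<le> q\<close> in auto)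
  also have "\<eta> * L * B / (1 - (q + \<eta> * \<epsilon> * L)) \<le> sqrt 2 * \<eta> * L * B / (1 - (q + \<eta> * \<epsilon> * L))"
  proof (rule divide_right_mono)
    have "1 * (\<eta> * L * B) \<le> sqrt 2 * (\<eta> * L * B)"
      using \<eta>(1) constants by (intro mult_right_mono) auto
    then show "\<eta> * L * B \<le> sqrt 2 * \<eta> * L * B" by (simp add: mult.assoc)
  qed (use \<rho> in simp)
  finally show ?thesis
    using \<rho> by (simp add: Let_def q_def p_def)
qed

end
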